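(* Let $K_1, K_2\in \mathcal{S}^N(k)$ and let $\Omega\in\mathcal{S}^+(n)$. The equality $\hat\beta(\Omega , K_1) = \hat\beta(I , K_2)$ holds (for all $y\in\mathbb{R}^n$) if and only if $\Omega$ is of the form $$\Omega = X\Gamma X^\top + Z\Delta Z^\top$$ with some $\Gamma \in \mathcal{S}^+(k)$ and $\Delta \in \mathcal{S}^+(n-k)$ satisfying $$X^\top X\,\Gamma K_1 = K_2 .$$
   Context: All matrices are real. $\mathcal{S}^+(m)$ and $\mathcal{S}^N(m)$ denote the sets of $m\times m$ symmetric positive definite and symmetric positive semidefinite matrices, respectively; $I$ is an identity matrix of appropriate size. $X$ is a fixed $n\times k$ matrix with $n>k$ and $\mathrm{rank}(X)=k$. $Z$ is a fixed $n\times(n-k)$ matrix with $X^\top Z=0$ and $\mathrm{rank}(Z)=n-k$. For $\Psi\in\mathcal{S}^+(n)$, $K\in\mathcal{S}^N(k)$ and $y\in\mathbb{R}^n$, the general ridge estimator is $$\hat\beta(\Psi,K) = (X^\top \Psi^{-1}X + K)^{-1} X^\top \Psi^{-1}y .$$ Equality between two such estimators means equality for every $y\in\mathbb{R}^n$. (The matrix $\Omega$ is the dispersion matrix in the linear model $y=X\beta+\varepsilon$, $\mathsf{E}[\varepsilon]=0$, $\mathsf{E}[\varepsilon\varepsilon^\top]=\sigma^2\Omega$.) *)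

theory Defs
  imports "HOL-Analysis.Analysis"
begin

definition sym_pos_def :: "(real^'m^'m) set" where
  "sym_pos_def = {A. transpose A = A \<and> (\<forall>x. x \<noteq> 0 \<longrightarrow> x \<bullet> (A *v x) > 0)}"

definition sym_pos_semidef :: "(real^'m^'m) set" where
  "sym_pos_semidef = {A. transpose A = A \<and> (\<forall>x. x \<bullet> (A *v x) \<ge> 0)}"

(* An n x k matrix has type real^'k^'n. For X of full column rank, Psi in sym_pos_def and
   K in sym_pos_semidef both inverted matrices are positive definite, so matrix_inv denotes
   the true inverse. *)
definition ridge_estimator ::
  "real^'k^'n \<Rightarrow> real^'n^'n \<Rightarrow> real^'k^'k \<Rightarrow> real^'n \<Rightarrow> real^'k" where
  "ridge_estimator X \<Psi> K y =
     (matrix_inv (transpose X ** matrix_inv \<Psi> ** X + K) ** transpose X ** matrix_inv \<Psi>) *v y"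

end

theory Submission
  imports Defs
begin

text \<open>
  Write \<open>G = X\<^sup>T X\<close>. Two facts carry the equivalence.

  \<^item> Equality of the estimators forces \<open>X\<^sup>T \<Omega> Z = 0\<close>: applied to data of the form
    \<open>y = \<Omega> Z w\<close>, the estimator weighted by \<open>\<Omega>\<^sup>-\<^sup>1\<close> sees only \<open>X\<^sup>T Z w = 0\<close>, so the other one,
    which is an invertible matrix times \<open>X\<^sup>T y\<close>, has to vanish too
    (\<open>ridge_estimator_eq_imp_cross_zero\<close>). By the rank assumptions, the ranges of \<open>X\<close> and \<open>Z\<close>
    are orthogonal complements; \<open>\<Omega>\<close> is then block diagonal along this splitting, which is what
    \<open>\<Omega> = X \<Gamma> X\<^sup>T + Z \<Delta> Z\<^sup>T\<close> says (\<open>block_diagonal_decomposition\<close>).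

  \<^item> For such an \<open>\<Omega>\<close> we have \<open>X\<^sup>T \<Omega>\<^sup>-\<^sup>1 = \<Gamma>\<^sup>-\<^sup>1 G\<^sup>-\<^sup>1 X\<^sup>T\<close> and \<open>X\<^sup>T \<Omega>\<^sup>-\<^sup>1 X = \<Gamma>\<^sup>-\<^sup>1\<close>. As \<open>X\<^sup>T\<close> is
    surjective, the estimators agree exactly when
    \<open>(\<Gamma>\<^sup>-\<^sup>1 + K\<^sub>1)\<^sup>-\<^sup>1 \<Gamma>\<^sup>-\<^sup>1 G\<^sup>-\<^sup>1 = (G + K\<^sub>2)\<^sup>-\<^sup>1\<close>. Inverting both sides turns this into
    \<open>G \<Gamma> (\<Gamma>\<^sup>-\<^sup>1 + K\<^sub>1) = G + K\<^sub>2\<close>, that is, \<open>G \<Gamma> K\<^sub>1 = K\<^sub>2\<close>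
    (\<open>ridge_estimator_eq_iff_penalty\<close>).

  Because the second fact is an equivalence, it also settles the converse direction.
\<close>

section \<open>Positive definite matrices\<close>

lemma matrix_mult_zero_right: "(A :: real^'b^'a) ** (0 :: real^'c^'b) = 0"
  by (simp add: matrix_matrix_mult_def vec_eq_iff)

lemma matrix_mult_zero_left: "(0 :: real^'b^'a) ** (A :: real^'c^'b) = 0"
  by (simp add: matrix_matrix_mult_def vec_eq_iff)

lemma transpose_zero: "transpose (0 :: real^'b^'a) = 0"
  by (simp add: transpose_def vec_eq_iff)

lemma transpose_add: "transpose (A + B) = transpose A + transpose (B :: real^'b^'a)"
  by (simp add: transpose_def vec_eq_iff)

lemma matrix_add_rdistrib:
  fixes A B :: "real^'b^'a" and C :: "real^'c^'b"
  shows "(A + B) ** C = A ** C + B ** C"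
  by (simp add: matrix_matrix_mult_def vec_eq_iff distrib_right sum.distrib)

lemma
  assumes "invertible A"
  shows matrix_inv_left: "matrix_inv A ** A = mat 1"
    and matrix_inv_right: "A ** matrix_inv A = mat 1"
  using someI_ex[OF assms[unfolded invertible_def]] by (auto simp: matrix_inv_def)

lemma inner_congruence:
  fixes L :: "real^'k^'n" and A :: "real^'n^'n"
  shows "x \<bullet> ((transpose L ** A ** L) *v x) = (L *v x) \<bullet> (A *v (L *v x))"
proof -
  have "x \<bullet> ((transpose L ** A ** L) *v x) = x \<bullet> (transpose L *v (A *v (L *v x)))"
    by (simp add: matrix_vector_mul_assoc matrix_mul_assoc del: transpose_matrix_vector)
  also have "\<dots> = (x v* transpose L) \<bullet> (A *v (L *v x))"
    by (simp only: dot_lmul_matrix)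
  finally show ?thesis by simp
qed

lemma sym_pos_def_congruence:
  fixes L :: "real^'k^'n"
  assumes A: "A \<in> sym_pos_def" and L: "inj ((*v) L)"
  shows "transpose L ** A ** L \<in> sym_pos_def"
proof -
  have "L *v x \<noteq> 0" if "x \<noteq> 0" for x
    using injD[OF L, of x 0] that by auto
  then show ?thesis
    using A by (simp add: sym_pos_def_def inner_congruence matrix_transpose_mul matrix_mul_assoc)
qed

lemma sym_pos_def_gram:
  fixes L :: "real^'k^'n"
  assumes "inj ((*v) L)"
  shows "transpose L ** L \<in> sym_pos_def"
proof -
  have "(mat 1 :: real^'n^'n) \<in> sym_pos_def"
    by (simp add: sym_pos_def_def)
  from sym_pos_def_congruence[OF this assms] show ?thesis by simp
qed

lemma sym_pos_def_add_semidef: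
  "A \<in> sym_pos_def \<Longrightarrow> B \<in> sym_pos_semidef \<Longrightarrow> A + B \<in> sym_pos_def"
  by (auto simp: sym_pos_def_def sym_pos_semidef_def transpose_add algebra_simps
      intro: add_pos_nonneg)

lemma sym_pos_def_invertible:
  fixes A :: "real^'n^'n"
  assumes "A \<in> sym_pos_def"
  shows "invertible A"
proof -
  have "x = 0" if "A *v x = 0" for x
  proof (rule ccontr)
    assume "x \<noteq> 0"
    with assms have "x \<bullet> (A *v x) > 0" by (simp add: sym_pos_def_def)
    with that show False by simp
  qed
  then show ?thesis
    by (simp add: invertible_left_inverse matrix_left_invertible_ker)
qed

lemma matrix_inv_eqI:
  fixes A B :: "real^'n^'n"
  assumes "A ** B = mat 1"
  shows "matrix_inv A = B"
  by (metis assms invertible_right_inverse matrix_inv_left matrix_mul_assoc matrix_mul_lid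
      matrix_mul_rid)

text \<open>A symmetric inverse is a congruence transform of the original matrix,
  \<open>A\<^sup>-\<^sup>1 = (A\<^sup>-\<^sup>1)\<^sup>T A A\<^sup>-\<^sup>1\<close>, so it inherits definiteness.\<close>

lemma sym_pos_def_inv:
  fixes A :: "real^'n^'n"
  assumes A: "A \<in> sym_pos_def"
  shows "matrix_inv A \<in> sym_pos_def"
proof -
  have inv: "invertible A" by (rule sym_pos_def_invertible[OF A])
  let ?B = "matrix_inv A"
  have sym: "transpose A = A" using A by (simp add: sym_pos_def_def)
  have "transpose (?B ** A) = mat 1"
    using inv by (simp add: matrix_inv_left)
  then have symB: "transpose ?B = ?B"
    using sym by (metis matrix_inv_eqI matrix_transpose_mul)
  have "inj ((*v) ?B)"
    using inv by (metis inj_matrix_vector_mult invertible_def matrix_inv_left matrix_inv_right)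
  from sym_pos_def_congruence[OF A this] show ?thesis
    using inv by (simp add: symB matrix_inv_left)
qed

section \<open>Orthogonal complements and block decompositions\<close>

text \<open>Dimensions of orthogonal sets add up, so the two ranges leave no room for a third
  direction.\<close>

lemma orthogonal_ranges_span:
  fixes X :: "real^'k^'n" and Z :: "real^'m^'n"
  assumes orth: "transpose X ** Z = 0" and full: "rank X + rank Z = CARD('n)"
  shows "span (range ((*v) X) \<union> range ((*v) Z)) = UNIV"
proof -
  have "x \<bullet> z = 0" if "x \<in> range ((*v) X)" "z \<in> range ((*v) Z)" for x z
  proof -
    from that obtain a b where "x = X *v a" "z = Z *v b" by auto
    then have "x \<bullet> z = (a v* transpose X) \<bullet> (Z *v b)" by simp
    also have "\<dots> = a \<bullet> ((transpose X ** Z) *v b)"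
      by (simp only: dot_lmul_matrix matrix_vector_mul_assoc)
    finally show ?thesis by (simp add: orth)
  qed
  then have "dim (range ((*v) X) \<union> range ((*v) Z)) = rank X + rank Z"
    by (subst dim_orthogonal_sum) (auto simp: rank_dim_range)
  then show ?thesis
    using full by (simp flip: dim_eq_full)
qed

text \<open>The summands are the orthogonal projectors onto the ranges of \<open>X\<close> and \<open>Z\<close>. Their sum
  fixes every column of \<open>X\<close> and of \<open>Z\<close>, hence everything that these span.\<close>

lemma orthogonal_projectors_sum:
  fixes X :: "real^'k^'n" and Z :: "real^'m^'n"
  assumes injX: "inj ((*v) X)" and injZ: "inj ((*v) Z)"
    and orth: "transpose X ** Z = 0" and full: "rank X + rank Z = CARD('n)"
  shows "X ** matrix_inv (transpose X ** X) ** transpose X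
       + Z ** matrix_inv (transpose Z ** Z) ** transpose Z = mat 1"
    (is "?P + ?Q = mat 1")
proof -
  have orth': "transpose Z ** X = 0"
    using arg_cong[OF orth, of transpose]
    by (simp add: matrix_transpose_mul transpose_zero)
  have invX: "matrix_inv (transpose X ** X) ** transpose X ** X = mat 1"
    using matrix_inv_left[OF sym_pos_def_invertible[OF sym_pos_def_gram[OF injX]]]
    by (simp add: matrix_mul_assoc)
  have invZ: "matrix_inv (transpose Z ** Z) ** transpose Z ** Z = mat 1"
    using matrix_inv_left[OF sym_pos_def_invertible[OF sym_pos_def_gram[OF injZ]]]
    by (simp add: matrix_mul_assoc)
  have PQX: "(?P + ?Q) ** X = X"
  proof -
    have "?P ** X = X" "?Q ** X = 0"
      using invX orth' by (simp_all add: matrix_mul_assoc[symmetric] matrix_mult_zero_right)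
    then show ?thesis by (simp add: matrix_add_rdistrib)
  qed
  have PQZ: "(?P + ?Q) ** Z = Z"
  proof -
    have "?P ** Z = 0" "?Q ** Z = Z"
      using invZ orth by (simp_all add: matrix_mul_assoc[symmetric] matrix_mult_zero_right)
    then show ?thesis by (simp add: matrix_add_rdistrib)
  qed
  have "(?P + ?Q) *v v = v" for v
  proof -
    have "((*v) (?P + ?Q)) v = id v"
    proof (rule linear_eq_on_span[where f = "(*v) (?P + ?Q)" and g = id
          and B = "range ((*v) X) \<union> range ((*v) Z)"])
      show "v \<in> span (range ((*v) X) \<union> range ((*v) Z))"
        using orthogonal_ranges_span[OF orth full] by simp
      show "linear ((*v) (?P + ?Q))" by simp
      show "linear (id :: real^'n \<Rightarrow> real^'n)" by (rule linear_id)
      show "(?P + ?Q) *v u = id u" if "u \<in> range ((*v) X) \<union> range ((*v) Z)" for u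
        using that PQX PQZ by (auto simp: matrix_vector_mul_assoc)
    qed
    then show ?thesis by simp
  qed
  then show ?thesis by (simp add: matrix_eq)
qed

text \<open>Expanding \<open>\<Omega> = (P + Q) \<Omega> (P + Q)\<close> with the projectors \<open>P\<close> and \<open>Q\<close> onto the two ranges,
  the mixed terms contain the factor \<open>X\<^sup>T \<Omega> Z\<close> or its transpose and drop out. The terms
  \<open>P \<Omega> P\<close> and \<open>Q \<Omega> Q\<close> then show what \<open>\<Gamma>\<close> and \<open>\<Delta>\<close> have to be.\<close>

lemma block_diagonal_decomposition:
  fixes X :: "real^'k^'n" and Z :: "real^'m^'n" and \<Omega> :: "real^'n^'n"
  assumes injX: "inj ((*v) X)" and injZ: "inj ((*v) Z)"
    and orth: "transpose X ** Z = 0" and full: "rank X + rank Z = CARD('n)"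
    and \<Omega>: "\<Omega> \<in> sym_pos_def" and cross: "transpose X ** \<Omega> ** Z = 0"
  obtains \<Gamma> :: "real^'k^'k" and \<Delta> :: "real^'m^'m"
  where "\<Gamma> \<in> sym_pos_def" "\<Delta> \<in> sym_pos_def"
    "\<Omega> = X ** \<Gamma> ** transpose X + Z ** \<Delta> ** transpose Z"
proof
  let ?G = "matrix_inv (transpose X ** X)" and ?H = "matrix_inv (transpose Z ** Z)"
  let ?\<Gamma> = "?G ** (transpose X ** \<Omega> ** X) ** ?G" and ?\<Delta> = "?H ** (transpose Z ** \<Omega> ** Z) ** ?H"
  let ?P = "X ** ?G ** transpose X" and ?Q = "Z ** ?H ** transpose Z"
  have G: "?G \<in> sym_pos_def" and H: "?H \<in> sym_pos_def"
    using injX injZ by (simp_all add: sym_pos_def_inv sym_pos_def_gram)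
  have sandwich: "B ** A ** B \<in> sym_pos_def"
    if "A \<in> sym_pos_def" "B \<in> sym_pos_def" for A B :: "real^'a^'a"
  proof -
    have "inj ((*v) B)"
      by (intro inj_matrix_vector_mult sym_pos_def_invertible that)
    from sym_pos_def_congruence[OF that(1) this] show ?thesis
      using that(2) by (simp add: sym_pos_def_def)
  qed
  show "?\<Gamma> \<in> sym_pos_def"
    by (intro sandwich sym_pos_def_congruence \<Omega> injX G)
  show "?\<Delta> \<in> sym_pos_def"
    by (intro sandwich sym_pos_def_congruence \<Omega> injZ H)
  have cross': "transpose Z ** \<Omega> ** X = 0"
    using arg_cong[OF cross, of transpose] \<Omega>
    by (simp add: matrix_transpose_mul sym_pos_def_def matrix_mul_assoc transpose_zero)
  have PQ: "?P ** \<Omega> ** ?Q = 0"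
  proof -
    have "?P ** \<Omega> ** ?Q = X ** ?G ** (transpose X ** \<Omega> ** Z) ** ?H ** transpose Z"
      by (simp add: matrix_mul_assoc)
    then show ?thesis by (simp add: cross matrix_mult_zero_left matrix_mult_zero_right)
  qed
  have QP: "?Q ** \<Omega> ** ?P = 0"
  proof -
    have "?Q ** \<Omega> ** ?P = Z ** ?H ** (transpose Z ** \<Omega> ** X) ** ?G ** transpose X"
      by (simp add: matrix_mul_assoc)
    then show ?thesis by (simp add: cross' matrix_mult_zero_left matrix_mult_zero_right)
  qed
  have "\<Omega> = (?P + ?Q) ** \<Omega> ** (?P + ?Q)"
    by (simp add: orthogonal_projectors_sum[OF injX injZ orth full])
  also have "\<dots> = ?P ** \<Omega> ** ?P + ?Q ** \<Omega> ** ?Q"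
    using PQ QP by (simp add: matrix_add_ldistrib matrix_add_rdistrib)
  also have "\<dots> = X ** ?\<Gamma> ** transpose X + Z ** ?\<Delta> ** transpose Z"
    by (simp add: matrix_mul_assoc)
  finally show "\<Omega> = X ** ?\<Gamma> ** transpose X + Z ** ?\<Delta> ** transpose Z" .
qed

section \<open>Equality of ridge estimators\<close>

lemma ridge_estimator_eq_iff:
  "(\<forall>y. ridge_estimator X \<Psi> K y = ridge_estimator X \<Phi> L y) \<longleftrightarrow>
    matrix_inv (transpose X ** matrix_inv \<Psi> ** X + K) ** transpose X ** matrix_inv \<Psi> =
    matrix_inv (transpose X ** matrix_inv \<Phi> ** X + L) ** transpose X ** matrix_inv \<Phi>"
  by (simp add: ridge_estimator_def matrix_eq)

lemma matrix_inv_mat_1: "matrix_inv (mat 1 :: real^'n^'n) = mat 1"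
  by (rule matrix_inv_eqI) simp

text \<open>Multiplying the estimator matrices by \<open>\<Omega> Z\<close> on the right annihilates the one weighted by
  \<open>\<Omega>\<^sup>-\<^sup>1\<close>, since \<open>X\<^sup>T Z = 0\<close>, and leaves \<open>(G + K\<^sub>2)\<^sup>-\<^sup>1 X\<^sup>T \<Omega> Z\<close> on the other side.\<close>

lemma ridge_estimator_eq_imp_cross_zero:
  fixes X :: "real^'k^'n" and Z :: "real^'m^'n"
  assumes injX: "inj ((*v) X)" and orth: "transpose X ** Z = 0"
    and K2: "K\<^sub>2 \<in> sym_pos_semidef" and \<Omega>: "\<Omega> \<in> sym_pos_def"
    and eq: "\<forall>y. ridge_estimator X \<Omega> K\<^sub>1 y = ridge_estimator X (mat 1) K\<^sub>2 y"
  shows "transpose X ** \<Omega> ** Z = 0"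
proof -
  let ?A = "matrix_inv (transpose X ** matrix_inv \<Omega> ** X + K\<^sub>1)"
  let ?M = "transpose X ** X + K\<^sub>2"
  have M: "invertible ?M"
    by (intro sym_pos_def_invertible sym_pos_def_add_semidef sym_pos_def_gram injX K2)
  have "?A ** transpose X ** matrix_inv \<Omega> = matrix_inv ?M ** transpose X"
    using eq by (simp add: ridge_estimator_eq_iff matrix_inv_mat_1)
  then have "?A ** transpose X ** matrix_inv \<Omega> ** (\<Omega> ** Z) = matrix_inv ?M ** transpose X ** (\<Omega> ** Z)"
    by simp
  moreover have "?A ** transpose X ** matrix_inv \<Omega> ** (\<Omega> ** Z) = 0"
  proof -
    have "?A ** transpose X ** matrix_inv \<Omega> ** (\<Omega> ** Z)
        = ?A ** (transpose X ** (matrix_inv \<Omega> ** \<Omega>) ** Z)"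
      by (simp only: matrix_mul_assoc)
    then show ?thesis
      using orth by (simp add: matrix_inv_left sym_pos_def_invertible[OF \<Omega>] matrix_mult_zero_right)
  qed
  ultimately have "?M ** (matrix_inv ?M ** transpose X ** (\<Omega> ** Z)) = 0"
    by (simp add: matrix_mult_zero_right)
  then show ?thesis
    using M by (simp add: matrix_mul_assoc matrix_inv_right)
qed

text \<open>Of the block form of \<open>\<Omega>\<close> only its product with \<open>X\<^sup>T\<close> enters, from which \<open>\<Delta>\<close> has
  disappeared: this is why the penalty condition constrains \<open>\<Gamma>\<close> alone.\<close>

lemma ridge_estimator_eq_iff_penalty:
  fixes X :: "real^'k^'n"
  assumes injX: "inj ((*v) X)"
    and K1: "K\<^sub>1 \<in> sym_pos_semidef" and K2: "K\<^sub>2 \<in> sym_pos_semidef"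
    and \<Omega>: "\<Omega> \<in> sym_pos_def" and \<Gamma>: "\<Gamma> \<in> sym_pos_def"
    and left: "transpose X ** \<Omega> = transpose X ** X ** \<Gamma> ** transpose X"
  shows "(\<forall>y. ridge_estimator X \<Omega> K\<^sub>1 y = ridge_estimator X (mat 1) K\<^sub>2 y) \<longleftrightarrow>
    transpose X ** X ** \<Gamma> ** K\<^sub>1 = K\<^sub>2"
proof -
  define G where "G = transpose X ** X"
  define M where "M = matrix_inv \<Gamma> + K\<^sub>1"
  define N where "N = G + K\<^sub>2"
  have G: "invertible G"
    unfolding G_def by (intro sym_pos_def_invertible sym_pos_def_gram injX)
  have \<Gamma>_inv: "invertible \<Gamma>" and \<Omega>_inv: "invertible \<Omega>"
    using \<Gamma> \<Omega> by (auto intro: sym_pos_def_invertible)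
  have M: "invertible M"
    unfolding M_def by (intro sym_pos_def_invertible sym_pos_def_add_semidef sym_pos_def_inv \<Gamma> K1)
  have N: "invertible N"
    unfolding N_def G_def by (intro sym_pos_def_invertible sym_pos_def_add_semidef sym_pos_def_gram injX K2)
  have XO: "transpose X ** matrix_inv \<Omega> = matrix_inv \<Gamma> ** matrix_inv G ** transpose X"
  proof -
    have "matrix_inv \<Gamma> ** matrix_inv G ** transpose X
        = matrix_inv \<Gamma> ** matrix_inv G ** (transpose X ** \<Omega>) ** matrix_inv \<Omega>"
      using \<Omega>_inv by (metis matrix_inv_right matrix_mul_assoc matrix_mul_rid)
    also have "\<dots> = matrix_inv \<Gamma> ** (matrix_inv G ** G) ** \<Gamma> ** transpose X ** matrix_inv \<Omega>"
      by (simp add: left G_def matrix_mul_assoc)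
    also have "\<dots> = transpose X ** matrix_inv \<Omega>"
      using G \<Gamma>_inv by (simp add: matrix_inv_left)
    finally show ?thesis by simp
  qed
  have XOX: "transpose X ** matrix_inv \<Omega> ** X = matrix_inv \<Gamma>"
  proof -
    have "transpose X ** matrix_inv \<Omega> ** X = matrix_inv \<Gamma> ** (matrix_inv G ** G)"
      by (simp add: XO G_def matrix_mul_assoc)
    then show ?thesis using G by (simp add: matrix_inv_left)
  qed
  have "(\<forall>y. ridge_estimator X \<Omega> K\<^sub>1 y = ridge_estimator X (mat 1) K\<^sub>2 y) \<longleftrightarrow>
      matrix_inv M ** matrix_inv \<Gamma> ** matrix_inv G ** transpose X = matrix_inv N ** transpose X"
  proof -
    have "matrix_inv M ** transpose X ** matrix_inv \<Omega>
        = matrix_inv M ** matrix_inv \<Gamma> ** matrix_inv G ** transpose X"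
      by (metis XO matrix_mul_assoc)
    then show ?thesis
      by (simp add: ridge_estimator_eq_iff matrix_inv_mat_1 XOX M_def N_def G_def)
  qed
  \<comment> \<open>\<open>X\<^sup>T\<close> has the right inverse \<open>X G\<^sup>-\<^sup>1\<close> and can be cancelled.\<close>
  also have "\<dots> \<longleftrightarrow> matrix_inv M ** matrix_inv \<Gamma> ** matrix_inv G = matrix_inv N"
  proof
    assume "matrix_inv M ** matrix_inv \<Gamma> ** matrix_inv G ** transpose X = matrix_inv N ** transpose X"
    then have "matrix_inv M ** matrix_inv \<Gamma> ** matrix_inv G ** transpose X ** (X ** matrix_inv G)
        = matrix_inv N ** transpose X ** (X ** matrix_inv G)"
      by simp
    then have "matrix_inv M ** matrix_inv \<Gamma> ** matrix_inv G ** (G ** matrix_inv G)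
        = matrix_inv N ** (G ** matrix_inv G)"
      by (simp add: G_def matrix_mul_assoc)
    then show "matrix_inv M ** matrix_inv \<Gamma> ** matrix_inv G = matrix_inv N"
      using G by (simp add: matrix_inv_right)
  qed simp
  also have "\<dots> \<longleftrightarrow> G ** \<Gamma> ** M = N"
  proof -
    have inverse: "matrix_inv M ** matrix_inv \<Gamma> ** matrix_inv G ** (G ** \<Gamma> ** M) = mat 1"
      using G \<Gamma>_inv M by (metis matrix_inv_left matrix_mul_assoc matrix_mul_rid)
    show ?thesis
      using inverse N
      by (metis matrix_inv_eqI matrix_inv_left matrix_inv_right matrix_left_right_inverse
          matrix_mul_assoc matrix_mul_lid matrix_mul_rid)
  qed
  also have "\<dots> \<longleftrightarrow> G ** \<Gamma> ** K\<^sub>1 = K\<^sub>2"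
  proof -
    have "G ** \<Gamma> ** M = G ** (\<Gamma> ** matrix_inv \<Gamma>) + G ** \<Gamma> ** K\<^sub>1"
      by (simp add: M_def matrix_add_ldistrib matrix_mul_assoc)
    then show ?thesis
      using \<Gamma>_inv by (simp add: N_def matrix_inv_right)
  qed
  finally show ?thesis by (simp add: G_def)
qed

theorem theorem1:
  fixes X :: "real^'k^'n" and Z :: "real^'m^'n"
    and K\<^sub>1 K\<^sub>2 :: "real^'k^'k" and \<Omega> :: "real^'n^'n"
  assumes "CARD('n) > CARD('k)"
    and "CARD('m) = CARD('n) - CARD('k)"
    and "rank X = CARD('k)"
    and "transpose X ** Z = 0"
    and "rank Z = CARD('n) - CARD('k)"
    and "K\<^sub>1 \<in> sym_pos_semidef" and "K\<^sub>2 \<in> sym_pos_semidef"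
    and "\<Omega> \<in> sym_pos_def"
  shows "(\<forall>y. ridge_estimator X \<Omega> K\<^sub>1 y = ridge_estimator X (mat 1) K\<^sub>2 y) \<longleftrightarrow>
    (\<exists>\<Gamma>\<in>(sym_pos_def :: (real^'k^'k) set). \<exists>\<Delta>\<in>(sym_pos_def :: (real^'m^'m) set).
       \<Omega> = X ** \<Gamma> ** transpose X + Z ** \<Delta> ** transpose Z \<and>
       transpose X ** X ** \<Gamma> ** K\<^sub>1 = K\<^sub>2)"
    (is "?equal \<longleftrightarrow> ?form")
proof -
  have injX: "inj ((*v) X)" and injZ: "inj ((*v) Z)"
    using assms by (simp_all flip: full_rank_injective)
  have full: "rank X + rank Z = CARD('n)"
    using assms by simp
  have penalty: "?equal \<longleftrightarrow> transpose X ** X ** \<Gamma> ** K\<^sub>1 = K\<^sub>2"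
    if \<Gamma>: "\<Gamma> \<in> sym_pos_def" and \<Omega>: "\<Omega> = X ** \<Gamma> ** transpose X + Z ** \<Delta> ** transpose Z"
    for \<Gamma> :: "real^'k^'k" and \<Delta> :: "real^'m^'m"
  proof (rule ridge_estimator_eq_iff_penalty[OF injX assms(6-8) \<Gamma>])
    show "transpose X ** \<Omega> = transpose X ** X ** \<Gamma> ** transpose X"
      by (simp add: \<Omega> matrix_add_ldistrib matrix_mul_assoc assms(4) matrix_mult_zero_left)
  qed
  show ?thesis
  proof
    assume eq: ?equal
    then have "transpose X ** \<Omega> ** Z = 0"
      by (rule ridge_estimator_eq_imp_cross_zero[OF injX assms(4,7,8)])
    then obtain \<Gamma> :: "real^'k^'k" and \<Delta> :: "real^'m^'m"
      where "\<Gamma> \<in> sym_pos_def" "\<Delta> \<in> sym_pos_def"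
        "\<Omega> = X ** \<Gamma> ** transpose X + Z ** \<Delta> ** transpose Z"
      by (rule block_diagonal_decomposition[OF injX injZ assms(4) full assms(8)])
    with penalty eq show ?form by blast
  next
    assume ?form
    with penalty show ?equal by blast
  qed
qed

end
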